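(* Consider the Zeckendorf game on $n$ with $p$ players and let $A$ be an alliance (set of players). Suppose there is an integer $b$ such that whenever player $i$ is not in $A$, player $(i-b) \bmod p$ is in $A$, and suppose $A$ contains at least $3b$ cyclically consecutive players. If $n \geq 2p+4b$, then $A$ has a winning strategy.
   Context: Let $F_1=1$, $F_2=2$, $F_{i+1}=F_i+F_{i-1}$. The Zeckendorf game on $n$ starts with the multiset of $n$ copies of $1$. A move is one of: if the list contains $F_{i-1}$ and $F_i$, replace them by $F_{i+1}$; if the list contains two copies of $F_i$: for $i=1$ replace them by $F_2$; for $i=2$ replace them by $F_1,F_3$; for $i\geq 3$ replace them by $F_{i-2},F_{i+1}$. The game ends when the list is the Zeckendorf decomposition of $n$ (distinct, pairwise non-consecutive Fibonacci numbers); every game terminates. With $p$ players, players $1,\dots,p$ (indices taken mod $p$) move in cyclic order $1,2,\dots,p,1,2,\dots$ starting with player 1; players $i$ and $i+1 \pmod p$ are consecutive. An alliance wins if the final move (creating the Zeckendorf decomposition) is made by one of its members; it has a winning strategy if its members can choose their moves so that the final move is made by a member no matter what moves the other players make.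
   Formalization: The integer b is assumed to be nonnegative; for negative b the claim as worded fails, e.g. p = 2, A = {1}, b = -1, n = 3, where the forced two-move game is won by player 2. *)

theory Defs
  imports "HOL-Number_Theory.Fib" "HOL-Library.Multiset"
begin

(* Fibonacci numbers with F_1 = 1, F_2 = 2, i.e. the library's sequence shifted by one.
   The value at index 0 is not part of the sequence; all uses below have index at least 1. *)
definition zfib :: "nat \<Rightarrow> nat" where
  "zfib i = fib (Suc i)"

definition zeckendorf_decomposition :: "nat \<Rightarrow> nat multiset \<Rightarrow> bool" where
  "zeckendorf_decomposition n M \<longleftrightarrow>
     (\<exists>S. finite S \<and> 0 \<notin> S \<and> (\<forall>i\<in>S. Suc i \<notin> S) \<and>
          M = image_mset zfib (mset_set S) \<and> sum_mset M = n)"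

inductive zmove :: "nat multiset \<Rightarrow> nat multiset \<Rightarrow> bool" where
  combine: "i \<ge> 2 \<Longrightarrow> zmove (N + {#zfib (i - 1), zfib i#}) (N + {#zfib (i + 1)#})"
| split1: "zmove (N + {#zfib 1, zfib 1#}) (N + {#zfib 2#})"
| split2: "zmove (N + {#zfib 2, zfib 2#}) (N + {#zfib 1, zfib 3#})"
| split: "i \<ge> 3 \<Longrightarrow> zmove (N + {#zfib i, zfib i#}) (N + {#zfib (i - 2), zfib (i + 1)#})"

(* A history is the nonempty list of all positions reached so far, starting with n copies of 1;
   a history with k + 1 entries records k moves. *)
definition history :: "nat \<Rightarrow> nat multiset list \<Rightarrow> bool" where
  "history n h \<longleftrightarrow> h \<noteq> [] \<and> hd h = replicate_mset n 1 \<and>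
     (\<forall>k. Suc k < length h \<longrightarrow>
        \<not> zeckendorf_decomposition n (h ! k) \<and> zmove (h ! k) (h ! Suc k))"

definition complete_game :: "nat \<Rightarrow> nat multiset list \<Rightarrow> bool" where
  "complete_game n h \<longleftrightarrow> history n h \<and> zeckendorf_decomposition n (last h)"

(* The representative in {1..p} of an index taken mod p. *)
definition player :: "nat \<Rightarrow> int \<Rightarrow> nat" where
  "player p i = nat ((i - 1) mod int p) + 1"

(* The moves are counted from 1, so the m-th move is made by player p m. *)
definition mover :: "nat \<Rightarrow> nat \<Rightarrow> nat" where
  "mover p m = player p (int m)"

(* A joint strategy of an alliance maps the history to the next position. *)
type_synonym strategy = "nat multiset list \<Rightarrow> nat multiset"

definition legal_strategy :: "nat \<Rightarrow> nat \<Rightarrow> nat set \<Rightarrow> strategy \<Rightarrow> bool" where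
  "legal_strategy n p A \<sigma> \<longleftrightarrow>
     (\<forall>h. history n h \<and> \<not> complete_game n h \<and> mover p (length h) \<in> A \<longrightarrow>
          zmove (last h) (\<sigma> h))"

definition follows :: "nat \<Rightarrow> nat set \<Rightarrow> strategy \<Rightarrow> nat multiset list \<Rightarrow> bool" where
  "follows p A \<sigma> h \<longleftrightarrow>
     (\<forall>m. 1 \<le> m \<and> m < length h \<and> mover p m \<in> A \<longrightarrow> h ! m = \<sigma> (take m h))"

(* A game in which no move is made (n at most 1) has no final move, so nobody wins it. *)
definition alliance_wins :: "nat \<Rightarrow> nat \<Rightarrow> nat set \<Rightarrow> nat multiset list \<Rightarrow> bool" where
  "alliance_wins n p A h \<longleftrightarrow>
     complete_game n h \<and> length h \<ge> 2 \<and> mover p (length h - 1) \<in> A"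

(* Quantifying over complete games loses nothing, since every game terminates. *)
definition has_winning_strategy :: "nat \<Rightarrow> nat \<Rightarrow> nat set \<Rightarrow> bool" where
  "has_winning_strategy n p A \<longleftrightarrow>
     (\<exists>\<sigma>. legal_strategy n p A \<sigma> \<and>
          (\<forall>h. complete_game n h \<and> follows p A \<sigma> h \<longrightarrow> alliance_wins n p A h))"

definition contains_consecutive :: "nat \<Rightarrow> nat set \<Rightarrow> int \<Rightarrow> bool" where
  "contains_consecutive p A l \<longleftrightarrow> (\<exists>s::int. \<forall>j\<in>{0..<l}. player p (s + j) \<in> A)"

end

theory Submission
  imports Defs
begin

text \<open>
  Strategy stealing. Four ones can be turned into \<open>F\<^sub>1 + F\<^sub>3\<close> in two moves (\<open>1, 1 \<rightarrow> 2\<close>;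
  \<open>1, 2 \<rightarrow> 3\<close>) or in three (\<open>1, 1 \<rightarrow> 2\<close> twice; \<open>2, 2 \<rightarrow> 1, 3\<close>). When the turn first comes to
  the \<open>3b\<close> consecutive members, at least \<open>4b\<close> ones are left, so the alliance can reach one and
  the same position \<open>X\<close> in \<open>2b\<close> or in \<open>3b\<close> moves. If it wins from \<open>X\<close> after \<open>3b\<close> moves, it does
  that. Otherwise it goes to \<open>X\<close> in \<open>2b\<close> moves and imagines every player \<open>i\<close> to be player
  \<open>i + b\<close>: every non-member is then impersonated by a member, so the alliance can play so as to
  make the imagined alliance fail, and the final move is made by a member.
\<close>

section \<open>Fibonacci values and the positions of the game\<close>

lemma zfib_numeral [simp]: "zfib (Suc 0) = 1" "zfib 2 = 2" "zfib 3 = 3"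
  by (simp_all add: zfib_def numeral_eq_Suc)

text \<open>The bound \<open>1 \<le> i\<close> matters: \<open>zfib 0\<close> and
  \<open>zfib 1\<close> are both 1.\<close>

lemma zfib_strict_mono: "1 \<le> i \<Longrightarrow> i < j \<Longrightarrow> zfib i < zfib j"
proof (induction j)
  case (Suc j)
  have "zfib j < zfib (Suc j)" if "1 \<le> j"
    using that by (cases j) (auto simp: zfib_def intro: fib_neq_0_nat)
  then show ?case using Suc by (cases "i = j") auto
qed simp

lemma zfib_inject: "1 \<le> i \<Longrightarrow> 1 \<le> j \<Longrightarrow> zfib i = zfib j \<longleftrightarrow> i = j"
  by (metis less_irrefl linorder_neqE_nat zfib_strict_mono)

lemma zfib_add: "i \<ge> 1 \<Longrightarrow> zfib (Suc i) = zfib i + zfib (i - 1)"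
  by (cases i) (simp_all add: zfib_def)

text \<open>An invariant of play that stands in for reachability; it is strong enough to make every
  stuck position a Zeckendorf decomposition.\<close>

definition position :: "nat \<Rightarrow> nat multiset \<Rightarrow> bool" where
  "position n P \<longleftrightarrow> set_mset P \<subseteq> zfib ` {1..} \<and> sum_mset P = n"

lemma position_start: "position n (replicate_mset n 1)"
proof -
  have "1 \<in> zfib ` {1..}" by (rule image_eqI[of _ _ 1]) auto
  then show ?thesis by (auto simp: position_def in_replicate_mset)
qed

lemma zmove_position:
  assumes "zmove P Q" "position n P"
  shows "position n Q"
proof -
  have mem: "zfib i \<in> zfib ` {1..}" if "1 \<le> i" for i using that by simp
  show ?thesis
    using assms(1)
  proof cases
    case (combine i N)
    then show ?thesis
      using assms(2) zfib_add[of i] mem[of "Suc i"] by (auto simp: position_def)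
  next
    case (split1 N)
    then show ?thesis using assms(2) mem[of 2] by (auto simp: position_def)
  next
    case (split2 N)
    then show ?thesis using assms(2) mem[of 3] mem[of 1] by (auto simp: position_def)
  next
    case (split i N)
    then have "zfib i = zfib (i - 1) + zfib (i - 2)"
      using zfib_add[of "i - 1"] by (simp add: numeral_2_eq_2)
    then show ?thesis
      using split assms(2) zfib_add[of i] mem[of "i - 2"] mem[of "Suc i"]
      by (auto simp: position_def)
  qed
qed

section \<open>Positions without a move\<close>

text \<open>Every move consumes two equal or two consecutive Fibonacci numbers, and a decomposition
  contains neither.\<close>

lemma zmove_not_zeckendorf:
  assumes "zmove P Q"
  shows "\<not> zeckendorf_decomposition n P"
proof
  assume "zeckendorf_decomposition n P"
  then obtain S where S: "finite S" "0 \<notin> S" "\<forall>i\<in>S. Suc i \<notin> S"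
    and P: "P = image_mset zfib (mset_set S)"
    by (auto simp: zeckendorf_decomposition_def)
  have pos: "1 \<le> i" if "i \<in> S" for i using that S(2) by (cases i) auto
  have mem: "i \<in> S" if "zfib i \<in># P" "1 \<le> i" for i
    using that pos S(1) P zfib_inject by auto
  have "inj_on zfib S" using pos zfib_inject by (auto intro!: inj_onI)
  then have "P = mset_set (zfib ` S)" by (simp add: P image_mset_mset_set)
  then have "count P x \<le> 1" for x by (simp add: count_mset_set')
  then have dup: "P \<noteq> N + {#x, x#}" for N x
    by (metis add_mset_add_single count_add_mset le_zero_eq Suc_le_mono One_nat_def nat.distinct(1)
        union_mset_add_mset_right)
  show False
    using assms
  proof cases
    case (combine i N)
    then have "i - 1 \<in> S" "i \<in> S" by (auto intro!: mem)
    then show ?thesis using S(3) combine(3) by (cases i) auto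
  qed (use dup in auto)
qed

text \<open>If no move applies, the splitting rules exclude repeated parts and
  \<open>combine\<close> excludes neighbouring indices, so the list is a decomposition.\<close>

lemma zmove_exists:
  assumes P: "position n P" and "\<not> zeckendorf_decomposition n P"
  shows "\<exists>Q. zmove P Q"
proof (rule ccontr)
  assume stuck: "\<nexists>Q. zmove P Q"
  define S where "S = {i. 1 \<le> i \<and> zfib i \<in># P}"
  have inj: "inj_on zfib S" by (intro inj_onI) (simp add: S_def zfib_inject)
  have img: "zfib ` S = set_mset P" using P by (auto simp: S_def position_def)
  then have fin: "finite S" using inj by (metis finite_imageD finite_set_mset)
  have dup: "P \<noteq> N + {#zfib i, zfib i#}" if "1 \<le> i" for i N
  proof -
    from that consider "i = 1" | "i = 2" | "i \<ge> 3" by linarith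
    then show ?thesis by cases (use stuck zmove.intros in blast)+
  qed
  have "count P x = count (mset_set (zfib ` S)) x" for x
  proof (cases "x \<in># P")
    case True
    then obtain i where i: "i \<in> S" "x = zfib i" using img by auto
    have "\<not> 2 \<le> count P x"
    proof
      assume "2 \<le> count P x"
      then have "{#x, x#} \<subseteq># P" by (auto simp: subseteq_mset_def)
      then have "P = (P - {#x, x#}) + {#x, x#}" by (rule subset_mset.diff_add[symmetric])
      then show False using dup[of i] i by (auto simp: S_def)
    qed
    then have "count P x = 1" using True count_greater_zero_iff[of P x] by linarith
    then show ?thesis using True img fin by simp
  qed (use img fin in \<open>simp add: not_in_iff\<close>)
  then have "P = mset_set (zfib ` S)" by (simp add: multiset_eq_iff)
  also have "\<dots> = image_mset zfib (mset_set S)" by (simp add: image_mset_mset_set inj)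
  finally have eq: "P = image_mset zfib (mset_set S)" .
  have "Suc i \<notin> S" if i: "i \<in> S" for i
  proof
    assume i': "Suc i \<in> S"
    have "zfib i \<noteq> zfib (Suc i)" using i i' zfib_inject by (auto simp: S_def)
    then have "{#zfib i, zfib (Suc i)#} \<subseteq># P"
      using i i' by (auto simp: S_def subseteq_mset_def not_in_iff Suc_le_eq)
    then have "(P - {#zfib i, zfib (Suc i)#}) + {#zfib i, zfib (Suc i)#} = P"
      by (rule subset_mset.diff_add)
    moreover have "2 \<le> Suc i" using i by (simp add: S_def)
    ultimately show False
      using stuck zmove.combine[of "Suc i" "P - {#zfib i, zfib (Suc i)#}"] by auto
  qed
  moreover have "0 \<notin> S" "sum_mset P = n" using P by (simp_all add: S_def position_def)
  ultimately have "zeckendorf_decomposition n P"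
    unfolding zeckendorf_decomposition_def using eq fin by blast
  then show False using assms(2) by simp
qed

section \<open>Supply of ones and local sequences of moves\<close>

lemma count_ones_zmove:
  assumes "zmove P Q"
  shows "count P 1 \<le> count Q 1 + 2"
  using assms by cases auto

lemma zmove_add: "zmove P Q \<Longrightarrow> zmove (R + P) (R + Q)"
proof (induction rule: zmove.induct)
  case (combine i N)
  then show ?case using zmove.combine[of i "R + N"] by (simp only: add.assoc)
next
  case (split1 N)
  show ?case using zmove.split1[of "R + N"] by (simp only: add.assoc)
next
  case (split2 N)
  show ?case using zmove.split2[of "R + N"] by (simp only: add.assoc)
next
  case (split i N)
  then show ?case using zmove.split[of i "R + N"] by (simp only: add.assoc)
qed

text \<open>Moves are local, so a sequence found on a few ones can be played inside any larger
  position.\<close>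

lemma zmoves_add: "(zmove ^^ k) P Q \<Longrightarrow> (zmove ^^ k) (R + P) (R + Q)"
proof (induction k arbitrary: Q)
  case (Suc k)
  then obtain S where "(zmove ^^ k) P S" "zmove S Q" by auto
  then show ?case using Suc.IH zmove_add[of S Q R] by auto
qed simp

lemma zmove_112: "zmove {#1, 1#} {#2#}"
  using zmove.split1[of "{#}"] by simp

lemma zmove_two_ones:
  assumes "2 \<le> count P 1"
  shows "\<exists>Q. zmove P Q"
proof -
  have "{#1, 1#} \<subseteq># P" using assms by (auto simp: subseteq_mset_def)
  then have "(P - {#1, 1#}) + {#1, 1#} = P" by (rule subset_mset.diff_add)
  then show ?thesis using zmove_add[OF zmove_112, of "P - {#1, 1#}"] by auto
qed

lemma zmove_123: "zmove {#1, 2#} {#3#}"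
  using zmove.combine[of 2 "{#}"] by simp

lemma zmove_2213: "zmove {#2, 2#} {#1, 3#}"
  using zmove.split2[of "{#}"] by simp

lemma four_ones_two_moves: "(zmove ^^ 2) {#1, 1, 1, 1#} {#1, 3#}"
proof -
  have "zmove {#1, 1, 1, 1#} {#2, 1, 1#}" using zmove_add[OF zmove_112, of "{#1, 1#}"] by simp
  moreover have "zmove {#2, 1, 1#} {#1, 3#}"
    using zmove_add[OF zmove_123, of "{#1#}"] by (simp add: add_mset_commute)
  ultimately show ?thesis by (auto simp: numeral_2_eq_2)
qed

lemma four_ones_three_moves: "(zmove ^^ 3) {#1, 1, 1, 1#} {#1, 3#}"
proof -
  have "zmove {#1, 1, 1, 1#} {#2, 1, 1#}" using zmove_add[OF zmove_112, of "{#1, 1#}"] by simp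
  moreover have "zmove {#2, 1, 1#} {#2, 2#}"
    using zmove_add[OF zmove_112, of "{#2#}"] by (simp add: add_mset_commute)
  ultimately show ?thesis using zmove_2213 by (auto simp: numeral_3_eq_3)
qed

lemma zmoves_repeat:
  assumes "(zmove ^^ k) P Q"
  shows "(zmove ^^ (k * b)) (repeat_mset b P) (repeat_mset b Q)"
proof (induction b)
  case (Suc b)
  have "(zmove ^^ k) (repeat_mset b P + P) (repeat_mset b P + Q)"
    using assms by (rule zmoves_add)
  moreover have "(zmove ^^ (k * b)) (Q + repeat_mset b P) (Q + repeat_mset b Q)"
    using Suc by (rule zmoves_add)
  ultimately have "(zmove ^^ (k + k * b)) (repeat_mset b P + P) (Q + repeat_mset b Q)"
    by (auto simp: relpowp_add add.commute)
  then show ?case by (simp add: add.commute)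
qed simp

text \<open>Treat \<open>b\<close> disjoint groups of four ones one after another, each in two moves
  or each in three.\<close>

lemma reach_in_two_lengths:
  assumes "4 * b \<le> count P 1"
  obtains X where "(zmove ^^ (2 * b)) P X" "(zmove ^^ (3 * b)) P X"
proof -
  let ?F = "repeat_mset b {#1, 1, 1, 1#} :: nat multiset"
  have "?F \<subseteq># P" using assms by (auto simp: subseteq_mset_def)
  then have P: "(P - ?F) + ?F = P" by (rule subset_mset.diff_add)
  have "(zmove ^^ (k * b)) P ((P - ?F) + repeat_mset b {#1, 3#})"
    if "(zmove ^^ k) {#1, 1, 1, 1#} {#1, 3#}" for k
    using zmoves_add[OF zmoves_repeat[OF that, of b], of "P - ?F"] P by metis
  then show ?thesis using that four_ones_two_moves four_ones_three_moves by blast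
qed

section \<open>Safe positions and strategy stealing\<close>

text \<open>
  The second argument is the number of moves made so far. As a greatest fixed point the predicate
  also holds where the alliance could merely keep the game going for ever. So neither the
  construction of a strategy from it nor the stealing argument needs termination of the game,
  since \<^const>\<open>has_winning_strategy\<close> only concerns complete games.
\<close>

coinductive safe :: "nat \<Rightarrow> nat \<Rightarrow> nat set \<Rightarrow> nat multiset \<Rightarrow> nat \<Rightarrow> bool" for n p A where
  finished: "zeckendorf_decomposition n P \<Longrightarrow> mover p t \<in> A \<Longrightarrow> safe n p A P t"
| member: "mover p (Suc t) \<in> A \<Longrightarrow> zmove P Q \<Longrightarrow> safe n p A Q (Suc t) \<Longrightarrow> safe n p A P t"
| outsider: "\<not> zeckendorf_decomposition n P \<Longrightarrow> mover p (Suc t) \<notin> A \<Longrightarrow>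
    (\<And>Q. zmove P Q \<Longrightarrow> safe n p A Q (Suc t)) \<Longrightarrow> safe n p A P t"

lemma safe_finished:
  "safe n p A P t \<Longrightarrow> zeckendorf_decomposition n P \<Longrightarrow> mover p t \<in> A"
  by (erule safe.cases) (auto dest: zmove_not_zeckendorf)

lemma safe_member:
  "safe n p A P t \<Longrightarrow> \<not> zeckendorf_decomposition n P \<Longrightarrow> mover p (Suc t) \<in> A \<Longrightarrow>
    \<exists>Q. zmove P Q \<and> safe n p A Q (Suc t)"
  by (erule safe.cases) auto

lemma safe_outsider:
  "safe n p A P t \<Longrightarrow> mover p (Suc t) \<notin> A \<Longrightarrow> zmove P Q \<Longrightarrow> safe n p A Q (Suc t)"
  by (erule safe.cases) (auto dest: zmove_not_zeckendorf)

text \<open>Failure at time \<open>t + b\<close> is the coinduction invariant. If the mover there is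
  a member, every move preserves failure; otherwise some move does, and by \<open>shift\<close> the
  mover at time \<open>t\<close> is a member and can choose it.\<close>

lemma safe_steal:
  assumes shift: "\<And>t. mover p (t + b) \<notin> A \<Longrightarrow> mover p t \<in> A"
    and "position n P" and "\<not> safe n p A P (t + b)"
  shows "safe n p A P t"
  using assms(2,3)
proof (coinduction arbitrary: P t)
  case (safe P t)
  show ?case
  proof (cases "zeckendorf_decomposition n P")
    case True
    then have "mover p (t + b) \<notin> A" using safe.finished safe(2) by blast
    then have "mover p t \<in> A" by (rule shift)
    then show ?thesis using True by simp
  next
    case False
    show ?thesis
    proof (cases "mover p (Suc t + b) \<in> A")
      case True
      then have "\<not> safe n p A Q (Suc t + b)" if "zmove P Q" for Q
        using safe.member[of p "t + b" A P Q n] that safe(2) by auto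
      then have follow: "position n Q \<and> \<not> safe n p A Q (Suc t + b)" if "zmove P Q" for Q
        using that zmove_position[OF that safe(1)] by simp
      \<comment> \<open>Needed only if the actual mover is a member, who must have some move to
        make.\<close>
      obtain Q where "zmove P Q" using zmove_exists[OF safe(1) False] by blast
      then show ?thesis using follow False by (cases "mover p (Suc t) \<in> A") auto
    next
      case outside: False
      then obtain Q where "zmove P Q" "\<not> safe n p A Q (Suc t + b)"
        using safe.outsider[of n P p "t + b" A] safe(2) False by auto
      moreover from this have "position n Q" using zmove_position safe(1) by blast
      ultimately show ?thesis using shift[OF outside] by auto
    qed
  qed
qed

lemma safe_along_path:
  assumes "(zmove ^^ k) P X" "safe n p A X (t + k)" "\<And>j. j < k \<Longrightarrow> mover p (Suc t + j) \<in> A"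
  shows "safe n p A P t"
  using assms
proof (induction k arbitrary: P t)
  case (Suc k)
  obtain Q where Q: "zmove P Q" "(zmove ^^ k) Q X" using relpowp_Suc_D2[OF Suc.prems(1)] by blast
  have "mover p (Suc (Suc t) + j) \<in> A" if "j < k" for j
    using Suc.prems(3)[of "Suc j"] that by simp
  then have "safe n p A Q (Suc t)" using Suc.IH[OF Q(2)] Suc.prems(2) by simp
  moreover have "mover p (Suc t) \<in> A" using Suc.prems(3)[of 0] by simp
  ultimately show ?case using safe.member[OF _ Q(1)] by simp
qed simp

text \<open>Here \<open>d\<close> counts the moves made before the block of members begins. Each
  uses up at most two ones, so \<open>4 * b\<close> ones remain for the block.\<close>

lemma safe_many_ones:
  assumes shift: "\<And>t. mover p (t + b) \<notin> A \<Longrightarrow> mover p t \<in> A"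
    and block: "\<And>j. j < 3 * b \<Longrightarrow> mover p (Suc t + d + j) \<in> A"
    and "position n P" and "4 * b + 2 * d \<le> count P 1"
  shows "safe n p A P t"
  using assms(2-)
proof (induction d arbitrary: P t)
  case 0
  then obtain X where X: "(zmove ^^ (2 * b)) P X" "(zmove ^^ (3 * b)) P X"
    using reach_in_two_lengths[of b P] by auto
  have path: "position n Y" if "(zmove ^^ k) P Y" for k Y
    using that by (induction k arbitrary: Y) (use 0 zmove_position in auto)
  show ?case
  proof (cases "safe n p A X (t + 3 * b)")
    case True
    show ?thesis using safe_along_path[OF X(2) True] 0(1) by simp
  next
    case False
    \<comment> \<open>The two arrivals at \<open>X\<close> differ by exactly the shift
      \<open>b\<close>.\<close>
    have "t + 3 * b = t + 2 * b + b" by simp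
    then have "safe n p A X (t + 2 * b)" using safe_steal[OF shift path[OF X(1)]] False by metis
    then show ?thesis using safe_along_path[OF X(1)] 0(1) by simp
  qed
next
  case (Suc d)
  \<comment> \<open>Before the block any move is harmless, whoever makes it.\<close>
  have next_safe: "safe n p A Q (Suc t)" if Q: "zmove P Q" for Q
    using Suc.prems count_ones_zmove[OF Q] zmove_position[OF Q] by (intro Suc.IH) auto
  have "\<exists>Q. zmove P Q" using Suc.prems(3) by (intro zmove_two_ones) simp
  then show ?case
    using next_safe safe.member[of p t A] safe.outsider[of n P p t A] zmove_not_zeckendorf by metis
qed

section \<open>From safe positions to a winning strategy\<close>

lemma history_position:
  "history n h \<Longrightarrow> k < length h \<Longrightarrow> position n (h ! k)"
proof (induction k)
  case 0
  then show ?case using position_start[of n] by (auto simp: history_def hd_conv_nth)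
next
  case (Suc k)
  then show ?case using zmove_position by (auto simp: history_def)
qed

lemma safe_start_wins:
  assumes "n \<ge> 2" and start: "safe n p A (replicate_mset n 1) 0"
  shows "has_winning_strategy n p A"
proof -
  \<comment> \<open>A history \<open>h\<close> records \<open>length h - 1\<close> moves, so
    \<open>length h\<close> is the count after the reply. The fallback is an arbitrary legal move,
    since legality is also required at histories from which no safe position can be reached in one
    move.\<close>
  define \<sigma> :: strategy where "\<sigma> h =
    (if \<exists>Q. zmove (last h) Q \<and> safe n p A Q (length h)
     then SOME Q. zmove (last h) Q \<and> safe n p A Q (length h)
     else SOME Q. zmove (last h) Q)" for h
  have \<sigma>_safe: "safe n p A (\<sigma> h) (length h)"
    if "\<exists>Q. zmove (last h) Q \<and> safe n p A Q (length h)" for h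
    using someI_ex[OF that] that by (simp add: \<sigma>_def)
  have "zmove (last h) (\<sigma> h)" if "history n h" "\<not> complete_game n h" for h
  proof -
    have "h \<noteq> []" using that(1) by (simp add: history_def)
    then have "position n (last h)" using history_position[OF that(1)] by (simp add: last_conv_nth)
    then have "\<exists>Q. zmove (last h) Q" using zmove_exists that by (auto simp: complete_game_def)
    then show ?thesis unfolding \<sigma>_def by (auto intro: someI2_ex)
  qed
  then have legal: "legal_strategy n p A \<sigma>" by (simp add: legal_strategy_def)
  have "alliance_wins n p A h" if h: "complete_game n h" "follows p A \<sigma> h" for h
  proof -
    have hist: "history n h" and "h \<noteq> []" and z: "zeckendorf_decomposition n (last h)"
      using h(1) by (auto simp: complete_game_def history_def)
    have h0: "h ! 0 = replicate_mset n 1" using hist by (auto simp: history_def hd_conv_nth)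
    have inv: "safe n p A (h ! k) k" if "k < length h" for k
      using that
    proof (induction k)
      case 0
      then show ?case using h0 start by simp
    next
      case (Suc k)
      have mv: "\<not> zeckendorf_decomposition n (h ! k)" "zmove (h ! k) (h ! Suc k)"
        using hist Suc.prems by (auto simp: history_def)
      have IH: "safe n p A (h ! k) k" using Suc by simp
      show ?case
      proof (cases "mover p (Suc k) \<in> A")
        case True
        have "last (take (Suc k) h) = h ! k" using Suc.prems by (simp add: take_Suc_conv_app_nth)
        then have "safe n p A (\<sigma> (take (Suc k) h)) (Suc k)"
          using \<sigma>_safe[of "take (Suc k) h"] safe_member[OF IH mv(1) True] Suc.prems by simp
        then show ?thesis using h(2) True Suc.prems by (auto simp: follows_def)
      next
        case False
        then show ?thesis using safe_outsider[OF IH] mv(2) by simp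
      qed
    qed
    \<comment> \<open>With \<open>n \<ge> 2\<close> the start is not final, so a last move
      exists.\<close>
    have "\<exists>Q. zmove (h ! 0) Q" using assms(1) h0 by (intro zmove_two_ones) simp
    then have "\<not> zeckendorf_decomposition n (h ! 0)" using zmove_not_zeckendorf by blast
    then have "length h - 1 \<noteq> 0" using z \<open>h \<noteq> []\<close> by (metis last_conv_nth)
    moreover have "mover p (length h - 1) \<in> A"
      using inv[of "length h - 1"] z \<open>h \<noteq> []\<close> by (simp add: safe_finished last_conv_nth)
    ultimately show ?thesis using h(1) by (simp add: alliance_wins_def)
  qed
  then show ?thesis using legal by (auto simp: has_winning_strategy_def)
qed

section \<open>Cyclic player indices and the final count\<close>

lemma player_mem: "p \<ge> 1 \<Longrightarrow> player p i \<in> {1..p}"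
  by (auto simp: player_def nat_less_iff Suc_le_eq)

lemma player_player_add: "p \<ge> 1 \<Longrightarrow> player p (int (player p i) + j) = player p (i + j)"
proof -
  assume "p \<ge> 1"
  then have "(int (player p i) + j - 1) mod int p = ((i - 1) mod int p + j) mod int p"
    by (simp add: player_def)
  also have "\<dots> = (i + j - 1) mod int p" by (simp add: mod_add_left_eq diff_add_eq)
  finally show ?thesis by (simp add: player_def)
qed

theorem theorem1p3p6:
  fixes n p :: nat and A :: "nat set" and b :: int
  assumes "p \<ge> 1"
    and "A \<subseteq> {1..p}"
    and "b \<ge> 0"
    and "\<And>i. i \<in> {1..p} \<Longrightarrow> i \<notin> A \<Longrightarrow> player p (int i - b) \<in> A"
    and "contains_consecutive p A (3 * b)"
    and "int n \<ge> 2 * int p + 4 * b"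
  shows "has_winning_strategy n p A"
proof -
  obtain c where b: "b = int c" using assms(3) nonneg_int_cases by blast
  obtain s where s: "\<forall>j\<in>{0..<3 * b}. player p (s + j) \<in> A"
    using assms(5) by (auto simp: contains_consecutive_def)
  \<comment> \<open>The block begins with player \<open>d + 1\<close>, whose first turn comes after
    \<open>d\<close> moves; \<open>d < p\<close> then gives
    \<open>4 * c + 2 * d \<le> n\<close>.\<close>
  define d where "d = player p s - 1"
  have d: "int (Suc d) = int (player p s)" "d < p"
    using player_mem[OF assms(1), of s] by (auto simp: d_def)
  \<comment> \<open>Apply the hypothesis on non-members to the mover of move \<open>t + c\<close>:
    going back \<open>b\<close> players gives the mover of move \<open>t\<close>.\<close>
  have shift: "mover p t \<in> A" if "mover p (t + c) \<notin> A" for t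
    using assms(4)[of "mover p (t + c)"] that player_mem[OF assms(1)]
      player_player_add[OF assms(1), of "int (t + c)" "- b"]
    by (simp add: mover_def b)
  have block: "mover p (Suc 0 + d + j) \<in> A" if "j < 3 * c" for j
  proof -
    have "mover p (Suc 0 + d + j) = player p (int (player p s) + int j)"
      using d(1) by (simp add: mover_def add.assoc[symmetric])
    also have "\<dots> = player p (s + int j)" by (rule player_player_add[OF assms(1)])
    finally show ?thesis using s that by (auto simp: b)
  qed
  have "4 * c + 2 * d \<le> n" "n \<ge> 2" using assms(1,6) d(2) by (auto simp: b)
  then show ?thesis
    using safe_start_wins safe_many_ones[OF shift block position_start] by simp
qed

end
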